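(* Let $\omega_1=\sqrt{2-\sqrt2}$. For $\varepsilon\neq0$ sufficiently small, the differential equation $$\theta_1''=-2\theta_1+\theta_2,\qquad \theta_2''=2\theta_1-2\theta_2+\varepsilon\,(1-\theta_1^2)\sin(\omega_1\tau)$$ has two periodic solutions $(\theta_1(\tau,\varepsilon),\theta_2(\tau,\varepsilon))$ tending when $\varepsilon\to0$ to the two periodic solutions $(\theta_1(\tau),\theta_2(\tau))$ of the unperturbed double pendulum ($\varepsilon=0$) given by $$\theta_1(\tau)=\frac{1}{\sqrt{4-2\sqrt2}}\bigl(X_0^*\cos(\omega_1\tau)+Y_0^*\sin(\omega_1\tau)\bigr),\qquad \theta_2(\tau)=\frac{1}{\sqrt{2-\sqrt2}}\bigl(X_0^*\cos(\omega_1\tau)+Y_0^*\sin(\omega_1\tau)\bigr)$$ with $$(X_0^*,Y_0^* )=\left(2\sqrt{2(2-\sqrt2)},\,0\right)\quad\text{and}\quad (X_0^*,Y_0^* )=\left(0,\,2\sqrt{\tfrac23(2-\sqrt2)}\right),$$ respectively.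
   Context: The prime denotes the derivative with respect to $\tau$, and $\varepsilon$ is a real parameter. The unperturbed double pendulum is $\theta_1''=-2\theta_1+\theta_2$, $\theta_2''=2\theta_1-2\theta_2$. "Tending" means $\theta_k(\tau,\varepsilon)\to\theta_k(\tau)$ as $\varepsilon\to0$ for $k=1,2$ and every $\tau$. The conclusion is an existence statement. *)

theory Defs
  imports "HOL-Analysis.Analysis" "HOL-Library.Periodic_Fun"
begin

definition omega1 :: real where
  "omega1 = sqrt (2 - sqrt 2)"

(* The functions v1 and v2 are the first derivatives of \<theta>1 and \<theta>2, so the last two
   derivative conditions are the second-order equations.  Solutions are global in time. *)
definition pendulum_solution :: "real \<Rightarrow> (real \<Rightarrow> real) \<Rightarrow> (real \<Rightarrow> real) \<Rightarrow> bool" where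
  "pendulum_solution \<epsilon> \<theta>1 \<theta>2 \<longleftrightarrow>
     (\<exists>v1 v2. \<forall>\<tau>.
        (\<theta>1 has_real_derivative v1 \<tau>) (at \<tau>) \<and>
        (\<theta>2 has_real_derivative v2 \<tau>) (at \<tau>) \<and>
        (v1 has_real_derivative (- 2 * \<theta>1 \<tau> + \<theta>2 \<tau>)) (at \<tau>) \<and>
        (v2 has_real_derivative
           (2 * \<theta>1 \<tau> - 2 * \<theta>2 \<tau> + \<epsilon> * (1 - (\<theta>1 \<tau>)\<^sup>2) * sin (omega1 * \<tau>))) (at \<tau>))"

(* periodic_fun_simple also admits period 0, hence the condition T > 0. *)
definition periodic_solution :: "real \<Rightarrow> (real \<Rightarrow> real) \<Rightarrow> (real \<Rightarrow> real) \<Rightarrow> bool" where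
  "periodic_solution \<epsilon> \<theta>1 \<theta>2 \<longleftrightarrow>
     pendulum_solution \<epsilon> \<theta>1 \<theta>2 \<and>
     (\<exists>T>0. periodic_fun_simple \<theta>1 T \<and> periodic_fun_simple \<theta>2 T)"

definition unperturbed1 :: "real \<Rightarrow> real \<Rightarrow> real \<Rightarrow> real" where
  "unperturbed1 X0 Y0 \<tau> =
     1 / sqrt (4 - 2 * sqrt 2) * (X0 * cos (omega1 * \<tau>) + Y0 * sin (omega1 * \<tau>))"

definition unperturbed2 :: "real \<Rightarrow> real \<Rightarrow> real \<Rightarrow> real" where
  "unperturbed2 X0 Y0 \<tau> =
     1 / sqrt (2 - sqrt 2) * (X0 * cos (omega1 * \<tau>) + Y0 * sin (omega1 * \<tau>))"

end

theory Submission
  imports Defs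
begin

text \<open>
  Lyapunov--Schmidt reduction. Put \<open>t = \<omega>\<^sub>1 \<tau>\<close>, \<open>e = \<epsilon> / \<omega>\<^sub>1\<^sup>2\<close>, \<open>c = 1 + \<surd>2\<close> (the quotient of the two frequencies) and
  \<open>g = (1 - \<theta>\<^sub>1\<^sup>2) sin t\<close>. The normal modes \<open>p = \<surd>2 \<theta>\<^sub>1 + \<theta>\<^sub>2\<close>, \<open>q = \<theta>\<^sub>2 - \<surd>2 \<theta>\<^sub>1\<close> satisfy \<open>p'' = - p + e g\<close>,
  \<open>q'' = - c\<^sup>2 q + e g\<close>. Since \<open>c\<close> is not an integer, the second equation has a \<open>2\<pi>\<close>-periodic solution
  for every \<open>2\<pi>\<close>-periodic \<open>g\<close>, whereas the first one requires \<open>g\<close> to be orthogonal to \<open>cos\<close> and \<open>sin\<close>.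
  At \<open>e = 0\<close> and \<open>\<theta>\<^sub>1 = A cos t + B sin t\<close> this orthogonality reads \<open>A B = 0\<close>, \<open>A\<^sup>2 + 3 B\<^sup>2 = 4\<close>, whose
  solutions are nondegenerate. Solving the linearised orthogonality conditions for the corrections of
  \<open>A\<close> and \<open>B\<close> yields one fixed point equation for the deviation \<open>\<eta>\<close> of \<open>\<theta>\<^sub>1\<close> from the
  unperturbed solution, which is a contraction on a small ball of continuous periodic functions.
\<close>


section \<open>Convolution over one period\<close>

text \<open>The shift sits on \<open>g\<close>, so the kernel is read only on one period and may
  take different values at its two ends; such a jump acts as a point source. At \<open>t = 0\<close>
  with kernel \<open>cos\<close> or \<open>sin\<close> and periodic \<open>g\<close> this is a
  Fourier coefficient of \<open>g\<close>, with reversed sign in the case of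
  \<open>sin\<close>.\<close>

definition conv :: "(real \<Rightarrow> real) \<Rightarrow> (real \<Rightarrow> real) \<Rightarrow> real \<Rightarrow> real" where
  "conv k g t = integral {0..2*pi} (\<lambda>s. k s * g (t - s))"

lemma continuous_reflect:
  assumes "continuous_on UNIV (g :: real \<Rightarrow> real)"
  shows "continuous_on A (\<lambda>s. g (t - s))"
  by (rule continuous_on_compose2[OF assms]) (auto intro!: continuous_intros)

lemma conv_integrable:
  fixes k g :: "real \<Rightarrow> real"
  assumes "continuous_on UNIV k" "continuous_on UNIV g"
  shows "(\<lambda>s. k s * g (t - s)) integrable_on {0..2*pi}"
  by (rule integrable_continuous_real)
    (intro continuous_on_mult continuous_reflect assms(2) continuous_on_subset[OF assms(1)] subset_UNIV)

lemma conv_diff: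
  assumes "continuous_on UNIV k" "continuous_on UNIV f" "continuous_on UNIV g"
  shows "conv k f t - conv k g t = conv k (\<lambda>s. f s - g s) t"
proof -
  have "conv k f t - conv k g t = integral {0..2*pi} (\<lambda>s. k s * f (t - s) - k s * g (t - s))"
    unfolding conv_def by (rule integral_diff[symmetric]) (intro conv_integrable assms)+
  then show ?thesis by (simp add: conv_def right_diff_distrib)
qed

lemma conv_bound:
  assumes "continuous_on UNIV k" "continuous_on UNIV g"
    and "\<And>s. s \<in> {0..2*pi} \<Longrightarrow> \<bar>k s\<bar> \<le> M" and "\<And>s. \<bar>g s\<bar> \<le> G"
  shows "\<bar>conv k g t\<bar> \<le> 2 * pi * M * G"
proof -
  have "0 \<le> M" using assms(3)[of 0] by auto
  then have "norm (k s * g (t - s)) \<le> M * G" if "s \<in> {0..2*pi}" for s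
    unfolding real_norm_def abs_mult using that assms by (intro mult_mono) auto
  then have "norm (conv k g t) \<le> (M * G) * (2*pi - 0)"
    unfolding conv_def
    by (intro integral_bound continuous_on_mult continuous_reflect assms(2)
        continuous_on_subset[OF assms(1)] subset_UNIV) auto
  then show ?thesis by (simp add: mult_ac)
qed

lemma continuous_antiderivative:
  assumes "continuous_on UNIV (g :: real \<Rightarrow> real)"
  obtains G where "\<And>x. (G has_real_derivative g x) (at x)"
proof -
  \<comment> \<open>Infinite end points make one antiderivative serve on the whole line.\<close>
  have "\<exists>G. \<forall>x::real. (-\<infinity>::ereal) < x \<longrightarrow> x < (\<infinity>::ereal) \<longrightarrow> (G has_vector_derivative g x) (at x)"
    using assms by (intro einterval_antiderivative) (auto simp: continuous_on_eq_continuous_at)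
  then show thesis using that by (auto simp: has_real_derivative_iff_has_vector_derivative)
qed

text \<open>Integrating by parts moves the derivative with respect to \<open>t\<close> onto the kernel, although
  \<open>g\<close> itself need not be differentiable.\<close>

lemma conv_has_derivative:
  assumes k: "\<And>s. (k has_real_derivative k' s) (at s)" and k': "continuous_on UNIV k'"
    and g: "continuous_on UNIV g" and per: "\<And>t. g (t + 2*pi) = g t"
  shows "(conv k g has_real_derivative (k 0 - k (2*pi)) * g t + conv k' g t) (at t)"
proof -
  obtain G where G: "\<And>x. (G has_real_derivative g x) (at x)"
    using continuous_antiderivative[OF g] by blast
  have contG: "continuous_on UNIV G"
    by (meson DERIV_isCont G continuous_at_imp_continuous_on)
  have contk: "continuous_on UNIV k"
    by (meson DERIV_isCont k continuous_at_imp_continuous_on)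
  have G_refl: "((\<lambda>s. G (t - s)) has_real_derivative - g (t - s)) (at s)" for t s
  proof -
    have "((\<lambda>s. t - s) has_real_derivative -1) (at s)" by (auto intro!: derivative_eq_intros)
    from DERIV_chain2[OF G this] show ?thesis by simp
  qed
  have G_shift: "((\<lambda>x. G (x - s)) has_real_derivative g (x - s)) (at x)" for x s
  proof -
    have "((\<lambda>x. x - s) has_real_derivative 1) (at x)" by (auto intro!: derivative_eq_intros)
    from DERIV_chain2[OF G this] show ?thesis by simp
  qed
  \<comment> \<open>After integration by parts the parameter \<open>x\<close> occurs only inside the
    differentiable \<open>G\<close>, so the Leibniz rule applies.\<close>
  have parts: "conv k g x = k 0 * G x - k (2*pi) * G (x - 2*pi)
      + integral {0..2*pi} (\<lambda>s. k' s * G (x - s))" for x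
  proof -
    have "((\<lambda>s. k' s * G (x - s) - k s * g (x - s)) has_integral
        (k (2*pi) * G (x - 2*pi) - k 0 * G (x - 0))) {0..2*pi}"
    proof (rule fundamental_theorem_of_calculus)
      fix s :: real assume "s \<in> {0..2*pi}"
      show "((\<lambda>s. k s * G (x - s)) has_vector_derivative k' s * G (x - s) - k s * g (x - s))
          (at s within {0..2*pi})"
        unfolding has_real_derivative_iff_has_vector_derivative[symmetric]
        by (auto intro!: derivative_eq_intros has_field_derivative_at_within[OF k]
              has_field_derivative_at_within[OF G_refl])
    qed simp
    moreover have "((\<lambda>s. k' s * G (x - s) - k s * g (x - s)) has_integral
        (integral {0..2*pi} (\<lambda>s. k' s * G (x - s)) - conv k g x)) {0..2*pi}"
      unfolding conv_def
      by (intro has_integral_diff integrable_integral conv_integrable k' contk contG g)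
    ultimately have "k (2*pi) * G (x - 2*pi) - k 0 * G (x - 0)
        = integral {0..2*pi} (\<lambda>s. k' s * G (x - s)) - conv k g x"
      by (rule has_integral_unique)
    then show ?thesis by simp
  qed
  have I: "((\<lambda>x. integral (cbox 0 (2*pi)) (\<lambda>s. k' s * G (x - s))) has_field_derivative
      integral (cbox 0 (2*pi)) (\<lambda>s. k' s * g (t - s))) (at t within UNIV)"
  proof (rule leibniz_rule_field_derivative)
    fix x s :: real
    show "((\<lambda>x. k' s * G (x - s)) has_real_derivative k' s * g (x - s)) (at x within UNIV)"
      by (rule DERIV_cmult[OF G_shift])
    show "(\<lambda>s. k' s * G (x - s)) integrable_on cbox 0 (2*pi)"
      using conv_integrable[OF k' contG] by simp
    show "continuous_on (UNIV \<times> cbox 0 (2*pi)) (\<lambda>(x, s). k' s * g (x - s))"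
      unfolding case_prod_beta
      by (intro continuous_intros continuous_on_compose2[OF k'] continuous_on_compose2[OF g]) auto
  qed auto
  \<comment> \<open>By periodicity both boundary terms have a multiple of \<open>g t\<close> as
    derivative, which gives the jump factor \<open>k 0 - k (2*pi)\<close>.\<close>
  have "g (t - 2*pi) = g t" using per[of "t - 2*pi"] by simp
  then have "((\<lambda>x. k 0 * G x - k (2*pi) * G (x - 2*pi)
      + integral {0..2*pi} (\<lambda>s. k' s * G (x - s))) has_real_derivative
      (k 0 - k (2*pi)) * g t + conv k' g t) (at t)"
    using I unfolding conv_def
    by (auto intro!: derivative_eq_intros G G_shift simp: algebra_simps)
  moreover have "conv k g = (\<lambda>x. k 0 * G x - k (2*pi) * G (x - 2*pi)
      + integral {0..2*pi} (\<lambda>s. k' s * G (x - s)))"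
    using parts by blast
  ultimately show ?thesis by simp
qed

section \<open>Solvability and periodic Green kernels of the two modes\<close>

lemma conv_periodic:
  assumes "\<And>t. g (t + 2*pi) = g t"
  shows "conv k g (t + 2*pi) = conv k g t"
proof -
  have "g (t + 2*pi - s) = g (t - s)" for s
    using assms[of "t - s"] by (simp add: algebra_simps)
  then show ?thesis by (simp add: conv_def)
qed

text \<open>The two convolutions rotate into each other: C' = -S and S' = C. Hence C^2 + S^2 is
  constant, and vanishing at 0 propagates to every \<open>t\<close>.\<close>

lemma conv_cos_vanishes:
  assumes g: "continuous_on UNIV g" and per: "\<And>t. g (t + 2*pi) = g t"
    and "conv cos g 0 = 0" "conv sin g 0 = 0"
  shows "conv cos g t = 0"
proof -
  have C: "(conv cos g has_real_derivative - conv sin g x) (at x)" for x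
  proof -
    have "conv (\<lambda>s. - sin s) g x = - conv sin g x" by (simp add: conv_def)
    then show ?thesis
      using conv_has_derivative[of cos "\<lambda>s. - sin s" g x, OF DERIV_cos
          continuous_on_minus[OF continuous_on_sin[OF continuous_on_id]] g per] by simp
  qed
  have S: "(conv sin g has_real_derivative conv cos g x) (at x)" for x
    using conv_has_derivative[of sin cos g x, OF DERIV_sin continuous_on_cos[OF continuous_on_id] g per]
    by simp
  have "((\<lambda>x. (conv cos g x)\<^sup>2 + (conv sin g x)\<^sup>2) has_real_derivative 0) (at x)" for x
    by (auto intro!: derivative_eq_intros C S)
  then have "(conv cos g t)\<^sup>2 + (conv sin g t)\<^sup>2 = (conv cos g 0)\<^sup>2 + (conv sin g 0)\<^sup>2"
    using DERIV_isconst_all[of "\<lambda>x. (conv cos g x)\<^sup>2 + (conv sin g x)\<^sup>2"] by blast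
  then show ?thesis using assms by (simp add: sum_power2_eq_zero_iff)
qed

lemma conv_lincomb:
  assumes "continuous_on UNIV f" "continuous_on UNIV h" "continuous_on UNIV g"
  shows "conv (\<lambda>s. a * f s + b * h s) g t = a * conv f g t + b * conv h g t"
proof -
  have "((\<lambda>s. a * (f s * g (t - s)) + b * (h s * g (t - s))) has_integral
      (a * conv f g t + b * conv h g t)) {0..2*pi}"
    unfolding conv_def
    by (intro has_integral_add has_integral_mult_right integrable_integral conv_integrable assms)
  then show ?thesis
    unfolding conv_def by (intro integral_unique) (simp add: algebra_simps)
qed

text \<open>The kernel is a \<open>2\<pi>\<close>-periodic solution of \<open>k'' + k = \<delta> - cos / \<pi>\<close>.\<close>

lemma resonant_kernel:
  defines "k \<equiv> \<lambda>s. - (s * sin s) / (2*pi)" and "k' \<equiv> \<lambda>s. - (sin s + s * cos s) / (2*pi)"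
  assumes g: "continuous_on UNIV g" and per: "\<And>t. g (t + 2*pi) = g t"
    and orth: "\<And>t. conv cos g t = 0"
  shows "(conv k g has_real_derivative conv k' g t) (at t)"
    and "(conv k' g has_real_derivative g t - conv k g t) (at t)"
proof -
  have d1: "(k has_real_derivative k' s) (at s)" for s
    unfolding k_def k'_def by (auto intro!: derivative_eq_intros simp: field_simps)
  \<comment> \<open>The cosine term is the price of resonance; the hypothesis \<open>orth\<close>
    removes its convolution. The jump of \<open>k'\<close> across the period is 1 and reproduces
    \<open>g\<close>.\<close>
  have d2: "(k' has_real_derivative (- 1 / pi * cos s + (-1) * k s)) (at s)" for s
    unfolding k_def k'_def by (auto intro!: derivative_eq_intros simp: field_simps)
  have c: "continuous_on UNIV k" "continuous_on UNIV k'"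
    unfolding k_def k'_def by (auto intro!: continuous_intros)
  show "(conv k g has_real_derivative conv k' g t) (at t)"
    using conv_has_derivative[OF d1 c(2) g per, of t] by (simp add: k_def)
  have "(conv k' g has_real_derivative (k' 0 - k' (2*pi)) * g t
      + conv (\<lambda>s. - 1 / pi * cos s + (-1) * k s) g t) (at t)"
    by (intro conv_has_derivative[OF d2 _ g per] continuous_intros c)
  then show "(conv k' g has_real_derivative g t - conv k g t) (at t)"
    by (subst (asm) conv_lincomb) (auto simp: c g orth k'_def intro!: continuous_intros)
qed

text \<open>The kernel is the \<open>2\<pi>\<close>-periodic Green function of
  \<open>x'' + c\<^sup>2 x\<close>. Being even about \<open>pi\<close> it agrees at both ends, while
  its derivative is odd about \<open>pi\<close> and is normalised to jump by 1.\<close>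

lemma nonresonant_kernel:
  fixes c :: real
  defines "k \<equiv> \<lambda>s. cos (c * (pi - s)) / (2 * c * sin (c * pi))"
    and "k' \<equiv> \<lambda>s. sin (c * (pi - s)) / (2 * sin (c * pi))"
  assumes c: "c \<noteq> 0" "sin (c * pi) \<noteq> 0"
    and g: "continuous_on UNIV g" and per: "\<And>t. g (t + 2*pi) = g t"
  shows "(conv k g has_real_derivative conv k' g t) (at t)"
    and "(conv k' g has_real_derivative g t - c\<^sup>2 * conv k g t) (at t)"
proof -
  have d1: "(k has_real_derivative k' s) (at s)" for s
    unfolding k_def k'_def using c by (auto intro!: derivative_eq_intros simp: field_simps)
  \<comment> \<open>The zero summand gives the form that \<open>conv_lincomb\<close>
    expects.\<close>
  have d2: "(k' has_real_derivative (- (c\<^sup>2) * k s + 0 * k s)) (at s)" for s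
    unfolding k_def k'_def using c
    by (auto intro!: derivative_eq_intros simp: field_simps power2_eq_square)
  have cont: "continuous_on UNIV k" "continuous_on UNIV k'"
    unfolding k_def k'_def using c by (auto intro!: continuous_intros)
  have refl: "c * (pi - 2*pi) = - (c * pi)" by algebra
  show "(conv k g has_real_derivative conv k' g t) (at t)"
    using conv_has_derivative[OF d1 cont(2) g per, of t] unfolding k_def refl by simp
  have "(conv k' g has_real_derivative (k' 0 - k' (2*pi)) * g t
      + conv (\<lambda>s. - (c\<^sup>2) * k s + 0 * k s) g t) (at t)"
    by (intro conv_has_derivative[OF d2 _ g per] continuous_intros cont)
  moreover have "k' 0 - k' (2*pi) = 1"
    unfolding k'_def refl using c by (simp add: field_simps)
  ultimately show "(conv k' g has_real_derivative g t - c\<^sup>2 * conv k g t) (at t)"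
    by (subst (asm) conv_lincomb) (auto simp: cont g)
qed

text \<open>The frequency ratio lies strictly between 2 and 3, so it is not an integer.\<close>

lemma nonresonance: "sin ((1 + sqrt 2) * pi) \<noteq> 0"
proof
  assume "sin ((1 + sqrt 2) * pi) = 0"
  then obtain i :: int where "(1 + sqrt 2) * pi = of_int i * pi"
    by (auto simp: sin_zero_iff_int2)
  then have "1 + sqrt 2 = of_int i" by simp
  moreover have "1 < sqrt 2" "sqrt 2 < 2" using sqrt2_less_2 by auto
  ultimately have "2 < real_of_int i \<and> real_of_int i < 3" by linarith
  then have "2 < i \<and> i < 3" by simp
  then show False by linarith
qed

section \<open>The fixed point equation\<close>

text \<open>The summand \<open>w\<close> is itself a function of \<open>\<eta>\<close> of size \<open>O(e)\<close>. Substituting it into the harmonic part makes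
  the latter \<open>O(e)\<close> plus quadratic, so that the map is a contraction in the plain supremum norm.\<close>

lemma reduced_fixed_point:
  assumes k: "\<And>s. (k has_real_derivative k' s) (at s)" and k': "continuous_on UNIV k'"
    and m: "continuous_on UNIV m1" "continuous_on UNIV m2"
    and us: "continuous_on UNIV us" and usper: "\<And>t. us (t + 2*pi) = us t"
    and U: "\<And>t. \<bar>us t\<bar> \<le> U"
  obtains C e0 where "0 \<le> C" "0 < e0"
    "\<And>e. \<bar>e\<bar> < e0 \<Longrightarrow> \<exists>\<eta> w. continuous_on UNIV \<eta> \<and> (\<forall>t. \<eta> (t + 2*pi) = \<eta> t)
       \<and> (\<forall>t. \<bar>\<eta> t\<bar> \<le> C * \<bar>e\<bar>)
       \<and> w = (\<lambda>t. e * conv k (\<lambda>s. (1 - (us s + \<eta> s)\<^sup>2) * sin s) t)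
       \<and> (\<forall>t. \<eta> t = cos t * conv m1 (\<lambda>s. 2 * us s * w s + (\<eta> s)\<^sup>2) 0
                   + sin t * conv m2 (\<lambda>s. 2 * us s * w s + (\<eta> s)\<^sup>2) 0 + w t)"
proof -
  have contk: "continuous_on UNIV k"
    by (meson DERIV_isCont k continuous_at_imp_continuous_on)
  have bdd: "\<exists>M. \<forall>s\<in>{0..2*pi}. \<bar>f s\<bar> \<le> M" if "continuous_on UNIV f" for f :: "real \<Rightarrow> real"
  proof -
    have "bounded (f ` {0..2*pi})"
      using that by (intro compact_imp_bounded compact_continuous_image) (auto intro: continuous_on_subset)
    then show ?thesis by (auto simp: bounded_iff)
  qed
  obtain M0 M1 M2 where M: "\<And>s. s \<in> {0..2*pi} \<Longrightarrow> \<bar>k s\<bar> \<le> M0" "\<And>s. s \<in> {0..2*pi} \<Longrightarrow> \<bar>m1 s\<bar> \<le> M1"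
    "\<And>s. s \<in> {0..2*pi} \<Longrightarrow> \<bar>m2 s\<bar> \<le> M2"
    using bdd[OF contk] bdd[OF m(1)] bdd[OF m(2)] by metis
  define M where "M = max M0 (max M1 M2)"
  have M: "\<And>s. s \<in> {0..2*pi} \<Longrightarrow> \<bar>k s\<bar> \<le> M" "\<And>s. s \<in> {0..2*pi} \<Longrightarrow> \<bar>m1 s\<bar> \<le> M"
    "\<And>s. s \<in> {0..2*pi} \<Longrightarrow> \<bar>m2 s\<bar> \<le> M"
    using M unfolding M_def by fastforce+
  define P where "P = 2 * pi * M"
  have "0 \<le> M" using M(1)[of 0] by auto
  then have P0: "0 \<le> P" by (simp add: P_def)
  have U0: "0 \<le> U" using U[of 0] by auto
  have cP: "\<bar>conv h g t\<bar> \<le> P * G" if "h = k \<or> h = m1 \<or> h = m2" "continuous_on UNIV g" "\<And>s. \<bar>g s\<bar> \<le> G"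
    for h g G t
    unfolding P_def using that M contk m by (intro conv_bound) auto
  \<comment> \<open>In the estimates below, \<open>\<bar>e\<bar> * L + 4 * P * \<rho>\<close> is the
    Lipschitz constant of the map and \<open>D * \<bar>e\<bar>\<close> bounds its value at 0. The
    choice of \<rho> makes \<open>4 * P * \<rho>\<close> at most 1/4; that of \<open>e0\<close>
    makes \<open>\<bar>e\<bar> * L\<close> at most 1/4 and \<open>D * \<bar>e\<bar>\<close> at most
    \<rho>/2. So the map contracts by 1/2 and keeps the ball of radius \<rho>.\<close>
  define L D \<rho> e0 where "L = P * (2 * U + 2) * (1 + 4 * P * U)"
    and "D = P * (1 + U\<^sup>2) * (1 + 4 * P * U)" and "\<rho> = 1 / (16 * P + 1)"
    and "e0 = min (1 / (4 * (L + 1))) (\<rho> / (2 * (D + 1)))"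
  have L0: "0 \<le> L" and D0: "0 \<le> D" and \<rho>0: "0 < \<rho>" and \<rho>1: "\<rho> \<le> 1" and P\<rho>: "4 * P * \<rho> \<le> 1 / 4"
    using P0 U0 by (auto simp: L_def D_def \<rho>_def field_simps)
  have e0: "0 < e0" using L0 D0 \<rho>0 by (auto simp: e0_def)
  define w where "w e \<eta> t = e * conv k (\<lambda>s. (1 - (us s + \<eta> s)\<^sup>2) * sin s) t" for e \<eta> t
  define N where "N e \<eta> s = 2 * us s * w e \<eta> s + (\<eta> s)\<^sup>2" for e \<eta> s
  define \<Phi> where "\<Phi> e \<eta> t = cos t * conv m1 (N e \<eta>) 0 + sin t * conv m2 (N e \<eta>) 0 + w e \<eta> t" for e \<eta> t
  define adm where "adm \<eta> \<longleftrightarrow> continuous_on UNIV \<eta> \<and> (\<forall>t. \<eta> (t + 2*pi) = \<eta> t) \<and> (\<forall>t. \<bar>\<eta> t\<bar> \<le> \<rho>)"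
    for \<eta> :: "real \<Rightarrow> real"
  have contg: "continuous_on UNIV (\<lambda>s. (1 - (us s + \<eta> s)\<^sup>2) * sin s)" if "adm \<eta>" for \<eta>
    using that us by (auto simp: adm_def intro!: continuous_intros)
  \<comment> \<open>Continuity in \<open>t\<close> comes from differentiability of the convolution,
    which uses that the forcing is periodic.\<close>
  have contw: "continuous_on UNIV (w e \<eta>)" if "adm \<eta>" for e \<eta>
  proof -
    have "(conv k (\<lambda>s. (1 - (us s + \<eta> s)\<^sup>2) * sin s) has_real_derivative
     (k 0 - k (2*pi)) * ((1 - (us t + \<eta> t)\<^sup>2) * sin t) + conv k' (\<lambda>s. (1 - (us s + \<eta> s)\<^sup>2) * sin s) t) (at t)" for t
      using that usper by (intro conv_has_derivative[OF k k' contg]) (auto simp: adm_def)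
    then have "continuous_on UNIV (conv k (\<lambda>s. (1 - (us s + \<eta> s)\<^sup>2) * sin s))"
      by (meson DERIV_isCont continuous_at_imp_continuous_on)
    then show ?thesis unfolding w_def by (intro continuous_intros) 
  qed
  have contN: "continuous_on UNIV (N e \<eta>)" if "adm \<eta>" for e \<eta>
    using that us contw[OF that] unfolding N_def by (auto simp: adm_def intro!: continuous_intros)
  have cont\<Phi>: "continuous_on UNIV (\<Phi> e \<eta>)" if "adm \<eta>" for e \<eta>
    unfolding \<Phi>_def using contw[OF that] by (intro continuous_intros)
  have per\<Phi>: "\<Phi> e \<eta> (t + 2*pi) = \<Phi> e \<eta> t" if "adm \<eta>" for e \<eta> t
    using that usper unfolding \<Phi>_def w_def adm_def by (subst conv_periodic) auto
  have combine: "\<bar>cos t * a + sin t * b + c\<bar> \<le> 2 * (P * n) + z"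
    if "\<bar>a\<bar> \<le> P * n" "\<bar>b\<bar> \<le> P * n" "\<bar>c\<bar> \<le> z" for a b c n z t :: real
  proof -
    have "\<bar>cos t * a\<bar> \<le> 1 * \<bar>a\<bar>" "\<bar>sin t * b\<bar> \<le> 1 * \<bar>b\<bar>"
      unfolding abs_mult by (intro mult_right_mono; simp)+
    then show ?thesis using that by linarith
  qed
  \<comment> \<open>The summand \<open>w\<close> varies with a factor \<open>\<bar>e\<bar>\<close>;
    the square varies with the factor \<open>2 * \<rho>\<close>, since it is a difference of squares
    on the ball. The two harmonics together turn the latter into
    \<open>4 * P * \<rho>\<close>.\<close>
  have lip: "\<bar>\<Phi> e \<eta> t - \<Phi> e \<eta>' t\<bar> \<le> (\<bar>e\<bar> * L + 4 * P * \<rho>) * d"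
    if a: "adm \<eta>" "adm \<eta>'" and d: "\<And>s. \<bar>\<eta> s - \<eta>' s\<bar> \<le> d" for e \<eta> \<eta>' t d
  proof -
    have d0: "0 \<le> d" using d[of 0] by auto
    have \<eta>b: "\<bar>\<eta> s\<bar> \<le> \<rho>" "\<bar>\<eta>' s\<bar> \<le> \<rho>" for s using a by (auto simp: adm_def)
    have gd: "\<bar>(1 - (us s + \<eta> s)\<^sup>2) * sin s - (1 - (us s + \<eta>' s)\<^sup>2) * sin s\<bar> \<le> (2 * U + 2) * d" for s
    proof -
      have "(1 - (us s + \<eta> s)\<^sup>2) * sin s - (1 - (us s + \<eta>' s)\<^sup>2) * sin s
        = (- (2 * us s + \<eta> s + \<eta>' s) * (\<eta> s - \<eta>' s)) * sin s" by algebra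
      also have "\<bar>\<dots>\<bar> \<le> ((2 * U + 2) * d) * 1"
        unfolding abs_mult
        using U[of s] \<eta>b[of s] \<rho>1 d[of s] d0 U0 by (intro mult_mono mult_nonneg_nonneg) auto
      finally show ?thesis by simp
    qed
    have wd: "\<bar>w e \<eta> s - w e \<eta>' s\<bar> \<le> \<bar>e\<bar> * (P * ((2 * U + 2) * d))" for s
    proof -
      have "w e \<eta> s - w e \<eta>' s = e * conv k (\<lambda>s. (1 - (us s + \<eta> s)\<^sup>2) * sin s - (1 - (us s + \<eta>' s)\<^sup>2) * sin s) s"
        unfolding w_def right_diff_distrib[symmetric]
        by (subst conv_diff[OF contk contg contg]) (use a in auto)
      also have "\<bar>\<dots>\<bar> \<le> \<bar>e\<bar> * (P * ((2 * U + 2) * d))"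
        unfolding abs_mult[of e]
        by (intro mult_left_mono cP continuous_on_diff contg a gd) auto
      finally show ?thesis .
    qed
    have Nd: "\<bar>N e \<eta> s - N e \<eta>' s\<bar> \<le> 2 * U * (\<bar>e\<bar> * (P * ((2 * U + 2) * d))) + 2 * \<rho> * d" for s
    proof -
      have "N e \<eta> s - N e \<eta>' s = 2 * us s * (w e \<eta> s - w e \<eta>' s) + (\<eta> s + \<eta>' s) * (\<eta> s - \<eta>' s)"
        unfolding N_def by algebra
      moreover have "\<bar>2 * us s * (w e \<eta> s - w e \<eta>' s)\<bar> \<le> 2 * U * (\<bar>e\<bar> * (P * ((2 * U + 2) * d)))"
        unfolding abs_mult[of "2 * us s"] using U[of s] U0 wd[of s] by (intro mult_mono) auto
      moreover have "\<bar>(\<eta> s + \<eta>' s) * (\<eta> s - \<eta>' s)\<bar> \<le> 2 * \<rho> * d"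
        unfolding abs_mult using \<eta>b[of s] d[of s] \<rho>0 by (intro mult_mono) auto
      ultimately show ?thesis by linarith
    qed
    have md: "\<bar>conv h (N e \<eta>) 0 - conv h (N e \<eta>') 0\<bar> \<le> P * (2 * U * (\<bar>e\<bar> * (P * ((2 * U + 2) * d))) + 2 * \<rho> * d)"
      if "h = m1 \<or> h = m2" for h
    proof -
      have "conv h (N e \<eta>) 0 - conv h (N e \<eta>') 0 = conv h (\<lambda>s. N e \<eta> s - N e \<eta>' s) 0"
        using that m contN a by (intro conv_diff) auto
      then show ?thesis
        using that Nd contN[OF a(1)] contN[OF a(2)] by (auto intro!: cP continuous_intros)
    qed
    have "\<Phi> e \<eta> t - \<Phi> e \<eta>' t = cos t * (conv m1 (N e \<eta>) 0 - conv m1 (N e \<eta>') 0)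
        + sin t * (conv m2 (N e \<eta>) 0 - conv m2 (N e \<eta>') 0) + (w e \<eta> t - w e \<eta>' t)"
      unfolding \<Phi>_def by algebra
    also have "\<bar>\<dots>\<bar> \<le> 2 * (P * (2 * U * (\<bar>e\<bar> * (P * ((2 * U + 2) * d))) + 2 * \<rho> * d))
        + \<bar>e\<bar> * (P * ((2 * U + 2) * d))"
      by (intro combine md wd) auto
    also have "\<dots> = (\<bar>e\<bar> * L + 4 * P * \<rho>) * d" unfolding L_def by algebra
    finally show ?thesis .
  qed
  have zero: "\<bar>\<Phi> e (\<lambda>_. 0) t\<bar> \<le> D * \<bar>e\<bar>" for e t
  proof -
    have a: "adm (\<lambda>_. 0)" using \<rho>0 by (auto simp: adm_def)
    have gb: "\<bar>(1 - (us s + 0)\<^sup>2) * sin s\<bar> \<le> 1 + U\<^sup>2" for s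
    proof -
      have "(us s)\<^sup>2 \<le> U\<^sup>2" using U[of s] by (metis abs_le_square_iff abs_of_nonneg U0)
      then have "\<bar>1 - (us s)\<^sup>2\<bar> \<le> 1 + U\<^sup>2" using zero_le_power2[of "us s"] zero_le_power2[of U] by linarith
      then have "\<bar>1 - (us s)\<^sup>2\<bar> * \<bar>sin s\<bar> \<le> (1 + U\<^sup>2) * 1" by (intro mult_mono) auto
      then show ?thesis by (simp add: abs_mult)
    qed
    have wb: "\<bar>w e (\<lambda>_. 0) s\<bar> \<le> \<bar>e\<bar> * (P * (1 + U\<^sup>2))" for s
      unfolding w_def abs_mult[of e] by (intro mult_left_mono cP contg a gb) auto
    have Nb: "\<bar>N e (\<lambda>_. 0) s\<bar> \<le> 2 * U * (\<bar>e\<bar> * (P * (1 + U\<^sup>2)))" for s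
    proof -
      have "\<bar>2 * us s\<bar> * \<bar>w e (\<lambda>_. 0) s\<bar> \<le> 2 * U * (\<bar>e\<bar> * (P * (1 + U\<^sup>2)))"
        using U[of s] U0 wb[of s] by (intro mult_mono) auto
      then show ?thesis by (simp add: N_def abs_mult)
    qed
    have "\<bar>\<Phi> e (\<lambda>_. 0) t\<bar> \<le> 2 * (P * (2 * U * (\<bar>e\<bar> * (P * (1 + U\<^sup>2))))) + \<bar>e\<bar> * (P * (1 + U\<^sup>2))"
      unfolding \<Phi>_def by (intro combine wb cP contN a Nb) auto
    also have "\<dots> = D * \<bar>e\<bar>" unfolding D_def by algebra
    finally show ?thesis .
  qed
  have main: "\<exists>\<eta>. adm \<eta> \<and> (\<forall>t. \<Phi> e \<eta> t = \<eta> t) \<and> (\<forall>t. \<bar>\<eta> t\<bar> \<le> 2 * D * \<bar>e\<bar>)" if e: "\<bar>e\<bar> < e0" for e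
  proof -
    have "\<bar>e\<bar> * (4 * (L + 1)) < 1" using e L0 by (simp add: e0_def field_simps)
    then have eL: "\<bar>e\<bar> * L \<le> 1 / 4" by (simp add: algebra_simps) 
    have "\<bar>e\<bar> * (2 * (D + 1)) < \<rho>" using e D0 by (simp add: e0_def field_simps)
    then have eD: "D * \<bar>e\<bar> \<le> \<rho> / 2" by (simp add: algebra_simps)
    have half: "\<bar>\<Phi> e \<eta> t - \<Phi> e \<eta>' t\<bar> \<le> 1 / 2 * d"
      if "adm \<eta>" "adm \<eta>'" and d: "\<And>s. \<bar>\<eta> s - \<eta>' s\<bar> \<le> d" for \<eta> \<eta>' t d
    proof -
      have "0 \<le> d" using d[of 0] by auto
      then have "(\<bar>e\<bar> * L + 4 * P * \<rho>) * d \<le> 1 / 2 * d"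
        using eL P\<rho> by (intro mult_right_mono) auto
      then show ?thesis using lip[OF that, of e t] by linarith
    qed
    have a0: "adm (\<lambda>_. 0)" using \<rho>0 by (auto simp: adm_def)
    have maps: "adm (\<Phi> e \<eta>)" if "adm \<eta>" for \<eta>
    proof -
      have "\<bar>\<Phi> e \<eta> t\<bar> \<le> \<rho>" for t
      proof -
        have "\<bar>\<Phi> e \<eta> t - \<Phi> e (\<lambda>_. 0) t\<bar> \<le> 1 / 2 * \<rho>"
          using that by (intro half a0) (auto simp: adm_def)
        then show ?thesis using zero[of e t] eD by linarith
      qed
      then show ?thesis using cont\<Phi>[OF that] per\<Phi>[OF that] by (auto simp: adm_def)
    qed
    \<comment> \<open>Banach's theorem is applied in the complete space of bounded continuous
      functions. On \<open>S\<close> the image is again continuous and bounded, so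
      \<open>Bcontfun\<close> wraps it faithfully.\<close>
    define S where "S = {x :: real \<Rightarrow>\<^sub>C real. adm (apply_bcontfun x)}"
    define T where "T x = Bcontfun (\<Phi> e (apply_bcontfun x))" for x
    have T: "apply_bcontfun (T x) = \<Phi> e (apply_bcontfun x)" if "x \<in> S" for x
      unfolding T_def using maps[of x] that
      by (intro Bcontfun_inverse) (auto simp: S_def adm_def intro!: bcontfun_normI[where b=\<rho>])
    \<comment> \<open>Periodicity and the bound survive pointwise limits; continuity is built into
      the type.\<close>
    have "closed S" unfolding closed_sequential_limits
    proof safe
      fix f l assume f: "\<forall>n. f n \<in> S" and l: "f \<longlonglongrightarrow> l"
      have pt: "(\<lambda>n. apply_bcontfun (f n) t) \<longlonglongrightarrow> apply_bcontfun l t" for t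
        using tendsto_bcontfun_uniform_limit[OF l] by (rule tendsto_uniform_limitI) simp
      have "apply_bcontfun l (t + 2*pi) = apply_bcontfun l t" for t
        using pt[of "t + 2*pi"] pt[of t] f by (auto simp: S_def adm_def intro: LIMSEQ_unique)
      moreover have "\<bar>apply_bcontfun l t\<bar> \<le> \<rho>" for t
        using tendsto_rabs[OF pt[of t]] f by (intro LIMSEQ_le_const2) (auto simp: S_def adm_def)
      ultimately show "l \<in> S" by (auto simp: S_def adm_def)
    qed
    moreover have "(0 :: real \<Rightarrow>\<^sub>C real) \<in> S"
      using \<rho>0 by (auto simp: S_def adm_def)
    moreover have "T ` S \<subseteq> S"
    proof (rule image_subsetI)
      fix x assume "x \<in> S"
      then show "T x \<in> S" using T[of x] maps[of x] by (simp add: S_def)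
    qed
    moreover have "dist (T x) (T y) \<le> 1 / 2 * dist x y" if "x \<in> S" "y \<in> S" for x y
    proof (rule dist_bound)
      fix t
      show "dist (apply_bcontfun (T x) t) (apply_bcontfun (T y) t) \<le> 1 / 2 * dist x y"
        unfolding T[OF that(1)] T[OF that(2)] dist_real_def
        using that dist_bounded[of x _ y] by (intro half) (auto simp: S_def dist_real_def)
    qed
    ultimately obtain x where x: "x \<in> S" "T x = x"
      using Banach_fix[of S "1/2" T] by (auto simp: complete_eq_closed)
    define \<eta> where "\<eta> = apply_bcontfun x"
    have \<eta>: "adm \<eta>" "\<And>t. \<Phi> e \<eta> t = \<eta> t"
      using x T[OF x(1)] by (auto simp: \<eta>_def S_def)
    \<comment> \<open>Comparing the fixed point with the image of 0 gives
      \<open>norm x \<le> norm x / 2 + D * \<bar>e\<bar>\<close>. This sharpens the radius \<rho> to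
      a bound linear in \<open>e\<close>, from which convergence follows later.\<close>
    have "\<bar>\<eta> s\<bar> \<le> norm x" for s using norm_bounded[of x s] by (simp add: \<eta>_def)
    then have h: "\<bar>\<Phi> e \<eta> t - \<Phi> e (\<lambda>_. 0) t\<bar> \<le> 1 / 2 * norm x" for t
      by (intro half \<eta> a0) auto
    have "norm x \<le> 1 / 2 * norm x + D * \<bar>e\<bar>"
    proof (rule norm_bound)
      fix t show "norm (apply_bcontfun x t) \<le> 1 / 2 * norm x + D * \<bar>e\<bar>"
        using h[of t] zero[of e t] \<eta>(2)[of t] unfolding \<eta>_def real_norm_def by linarith
    qed
    then have "\<bar>\<eta> t\<bar> \<le> 2 * D * \<bar>e\<bar>" for t
      using norm_bounded[of x t] by (simp add: \<eta>_def)
    with \<eta> show ?thesis by blast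
  qed
  show thesis
  proof (rule that[of "2 * D" e0])
    fix e assume "\<bar>e\<bar> < e0"
    then obtain \<eta> where \<eta>: "adm \<eta>" "\<And>t. \<Phi> e \<eta> t = \<eta> t" "\<And>t. \<bar>\<eta> t\<bar> \<le> 2 * D * \<bar>e\<bar>"
      using main by blast
    show "\<exists>\<eta> w. continuous_on UNIV \<eta> \<and> (\<forall>t. \<eta> (t + 2*pi) = \<eta> t)
       \<and> (\<forall>t. \<bar>\<eta> t\<bar> \<le> 2 * D * \<bar>e\<bar>)
       \<and> w = (\<lambda>t. e * conv k (\<lambda>s. (1 - (us s + \<eta> s)\<^sup>2) * sin s) t)
       \<and> (\<forall>t. \<eta> t = cos t * conv m1 (\<lambda>s. 2 * us s * w s + (\<eta> s)\<^sup>2) 0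
                   + sin t * conv m2 (\<lambda>s. 2 * us s * w s + (\<eta> s)\<^sup>2) 0 + w t)"
      using \<eta> by (intro exI[of _ \<eta>] exI[of _ "w e \<eta>"])
        (auto simp: adm_def \<Phi>_def N_def[abs_def] w_def[abs_def])
  qed (use D0 e0 in auto)
qed

section \<open>Averaged forcing\<close>

lemma trig_has_integral:
  "((\<lambda>s. sin s * cos s) has_integral 0) {0..2*pi}"
  "((\<lambda>s. sin s * cos s ^ 3) has_integral 0) {0..2*pi}"
  "((\<lambda>s. sin s ^ 3 * cos s) has_integral 0) {0..2*pi}"
  "((\<lambda>s. (sin s)\<^sup>2) has_integral pi) {0..2*pi}"
  "((\<lambda>s. (sin s)\<^sup>2 * (cos s)\<^sup>2) has_integral pi / 4) {0..2*pi}"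
  "((\<lambda>s. sin s ^ 4) has_integral 3 * pi / 4) {0..2*pi}"
proof -
  have FTC: "(f has_integral c) {0..2*pi}"
    if "\<And>s. (F has_real_derivative f s) (at s)" "F (2*pi) - F 0 = c" for F f c
    using fundamental_theorem_of_calculus[of 0 "2*pi" F f] that
    by (auto simp: has_real_derivative_iff_has_vector_derivative intro: has_vector_derivative_at_within)
  have pyth: "(cos s)\<^sup>2 = 1 - (sin s)\<^sup>2" for s :: real
    using sin_cos_squared_add[of s] by linarith
  show "((\<lambda>s. sin s * cos s) has_integral 0) {0..2*pi}"
    by (rule FTC[of "\<lambda>s. (sin s)\<^sup>2 / 2"]) (auto intro!: derivative_eq_intros)
  show "((\<lambda>s. sin s * cos s ^ 3) has_integral 0) {0..2*pi}"
    by (rule FTC[of "\<lambda>s. - (cos s ^ 4) / 4"]) (auto intro!: derivative_eq_intros)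
  show "((\<lambda>s. sin s ^ 3 * cos s) has_integral 0) {0..2*pi}"
    by (rule FTC[of "\<lambda>s. (sin s ^ 4) / 4"]) (auto intro!: derivative_eq_intros)
  show "((\<lambda>s. (sin s)\<^sup>2) has_integral pi) {0..2*pi}"
    by (rule FTC[of "\<lambda>s. (s - sin s * cos s) / 2"])
      (auto intro!: derivative_eq_intros simp: pyth power2_eq_square[symmetric])
  show 22: "((\<lambda>s. (sin s)\<^sup>2 * (cos s)\<^sup>2) has_integral pi / 4) {0..2*pi}"
  \<comment> \<open>The antiderivative is (s - sin(4s)/4)/8, written in powers of
    \<open>sin s\<close> and \<open>cos s\<close>.\<close>
  proof (rule FTC[of "\<lambda>s. (s - sin s * cos s * (1 - 2 * (sin s)\<^sup>2)) / 8"])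
    fix s :: real
    have "((\<lambda>s. s - sin s * cos s * (1 - 2 * (sin s)\<^sup>2)) has_real_derivative
      (1 - ((cos s)\<^sup>2 - (sin s)\<^sup>2) * (1 - 2 * (sin s)\<^sup>2) + 4 * (sin s)\<^sup>2 * (cos s)\<^sup>2)) (at s)"
      by (auto intro!: derivative_eq_intros simp: power2_eq_square algebra_simps)
    note DERIV_cdivide[OF this, of 8]
    also have "(1 - ((cos s)\<^sup>2 - (sin s)\<^sup>2) * (1 - 2 * (sin s)\<^sup>2) + 4 * (sin s)\<^sup>2 * (cos s)\<^sup>2) / 8
      = (sin s)\<^sup>2 * (cos s)\<^sup>2"
      unfolding pyth by (simp add: algebra_simps diff_divide_distrib)
    finally show "((\<lambda>s. (s - sin s * cos s * (1 - 2 * (sin s)\<^sup>2)) / 8) has_real_derivative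
      (sin s)\<^sup>2 * (cos s)\<^sup>2) (at s)" .
  qed simp
  \<comment> \<open>The integrand is the derivative of a periodic function, so the fourth power
    integrates to three times the mixed term.\<close>
  have "((\<lambda>s. 3 * ((sin s)\<^sup>2 * (cos s)\<^sup>2) - sin s ^ 4) has_integral 0) {0..2*pi}"
    by (rule FTC[of "\<lambda>s. sin s ^ 3 * cos s"])
      (auto intro!: derivative_eq_intros simp: algebra_simps power2_eq_square power3_eq_cube power4_eq_xxxx)
  from has_integral_diff[OF has_integral_mult_right[OF 22, of 3] this]
  show "((\<lambda>s. sin s ^ 4) has_integral 3 * pi / 4) {0..2*pi}" by simp
qed

text \<open>Expanding \<open>(us + \<eta>)\<^sup>2\<close>, the part quadratic in \<open>us\<close>
  and the product of \<open>us\<close> with the harmonics of \<eta> are integrated explicitly; all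
  the rest is \<open>N\<close>. The orthogonality conditions thus become linear equations for
  \<alpha> and \<beta> once \<open>N\<close> is regarded as given.\<close>

lemma forcing_harmonics:
  fixes A B \<alpha> \<beta> :: real and \<eta> w :: "real \<Rightarrow> real"
  assumes \<eta>: "\<And>t. \<eta> t = cos t * \<alpha> + sin t * \<beta> + w t" and w: "continuous_on UNIV w"
  defines "us \<equiv> \<lambda>t. A * cos t + B * sin t"
  defines "N \<equiv> \<lambda>s. 2 * us s * w s + (\<eta> s)\<^sup>2"
  defines "g \<equiv> \<lambda>s. (1 - (us s + \<eta> s)\<^sup>2) * sin s"
  shows "conv cos g 0 = - pi / 2 * (A * B + A * \<beta> + B * \<alpha>) + conv (\<lambda>s. sin s * cos s) N 0"
    and "conv sin g 0 = - pi + pi / 4 * (A\<^sup>2 + 2 * A * \<alpha>) + 3 * pi / 4 * (B\<^sup>2 + 2 * B * \<beta>)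
      + conv (\<lambda>s. (sin s)\<^sup>2) N 0"
proof -
  have contN: "continuous_on UNIV N"
    unfolding N_def us_def \<eta> by (intro continuous_intros w)
  \<comment> \<open>Convolution at 0 evaluates \<open>g\<close> at \<open>- s\<close>, which
    reverses the sign of every sine.\<close>
  have g: "g (0 - s) = - sin s * (1 - (A * cos s - B * sin s)\<^sup>2
      - 2 * (A * cos s - B * sin s) * (\<alpha> * cos s - \<beta> * sin s) - N (0 - s))" for s
    unfolding g_def N_def us_def \<eta> by (simp add: power2_eq_square algebra_simps)
  have int: "((\<lambda>s. f s * N (0 - s)) has_integral conv f N 0) {0..2*pi}" if "continuous_on UNIV f" for f
    unfolding conv_def using that contN by (intro integrable_integral conv_integrable)
  note T = trig_has_integral
  \<comment> \<open>These are the coefficients of cos^2, sin cos and sin^2 in the explicit quadratic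
    part; the reflection turns the sign of \<open>?b\<close>.\<close>
  let ?a = "A\<^sup>2 + 2 * A * \<alpha>" and ?b = "2 * (A * B + A * \<beta> + B * \<alpha>)" and ?c = "B\<^sup>2 + 2 * B * \<beta>"
  have "((\<lambda>s. ?a * (sin s * cos s ^ 3) - ?b * ((sin s)\<^sup>2 * (cos s)\<^sup>2) + ?c * (sin s ^ 3 * cos s)
      - sin s * cos s + (sin s * cos s) * N (0 - s)) has_integral
    (?a * 0 - ?b * (pi / 4) + ?c * 0 - 0 + conv (\<lambda>s. sin s * cos s) N 0)) {0..2*pi}"
    by (intro has_integral_add has_integral_diff has_integral_mult_right T int continuous_intros)
  moreover have "?a * (sin s * cos s ^ 3) - ?b * ((sin s)\<^sup>2 * (cos s)\<^sup>2) + ?c * (sin s ^ 3 * cos s)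
      - sin s * cos s + (sin s * cos s) * N (0 - s) = cos s * g (0 - s)" for s
    unfolding g by algebra
  ultimately show "conv cos g 0 = - pi / 2 * (A * B + A * \<beta> + B * \<alpha>) + conv (\<lambda>s. sin s * cos s) N 0"
    unfolding conv_def[of cos] by (intro integral_unique) (simp add: algebra_simps)
  have "((\<lambda>s. ?a * ((sin s)\<^sup>2 * (cos s)\<^sup>2) - ?b * (sin s ^ 3 * cos s) + ?c * (sin s ^ 4)
      - (sin s)\<^sup>2 + (sin s)\<^sup>2 * N (0 - s)) has_integral
    (?a * (pi / 4) - ?b * 0 + ?c * (3 * pi / 4) - pi + conv (\<lambda>s. (sin s)\<^sup>2) N 0)) {0..2*pi}"
    by (intro has_integral_add has_integral_diff has_integral_mult_right T int continuous_intros)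
  moreover have "?a * ((sin s)\<^sup>2 * (cos s)\<^sup>2) - ?b * (sin s ^ 3 * cos s) + ?c * (sin s ^ 4)
      - (sin s)\<^sup>2 + (sin s)\<^sup>2 * N (0 - s) = sin s * g (0 - s)" for s
    unfolding g by algebra
  ultimately show "conv sin g 0 = - pi + pi / 4 * (A\<^sup>2 + 2 * A * \<alpha>) + 3 * pi / 4 * (B\<^sup>2 + 2 * B * \<beta>)
      + conv (\<lambda>s. (sin s)\<^sup>2) N 0"
    unfolding conv_def[of sin] by (intro integral_unique) (simp add: algebra_simps)
qed

section \<open>The double pendulum\<close>

lemma omega1_squared: "omega1\<^sup>2 = 2 - sqrt 2"
  unfolding omega1_def using sqrt2_less_2 by simp

lemma omega1_pos: "0 < omega1"
  unfolding omega1_def using sqrt2_less_2 by simp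

text \<open>This returns from the time \<open>t\<close> to \<tau>. Here \<open>u\<close> stands for
  \<theta>1 and \<open>q\<close> for the mode \<theta>2 - sqrt 2 \<theta>1. In these variables the
  forcing enters only the equation of \<open>q\<close>, and \<open>q\<close> drives
  \<open>u\<close>.\<close>

lemma periodic_solution_rescale:
  fixes u v q r :: "real \<Rightarrow> real" and \<epsilon> :: real
  assumes u: "\<And>t. (u has_real_derivative v t) (at t)"
    and v: "\<And>t. (v has_real_derivative (- u t + (1 + sqrt 2) / sqrt 2 * q t)) (at t)"
    and q: "\<And>t. (q has_real_derivative r t) (at t)"
    and r: "\<And>t. (r has_real_derivative
      (\<epsilon> / omega1\<^sup>2 * ((1 - (u t)\<^sup>2) * sin t) - (1 + sqrt 2)\<^sup>2 * q t)) (at t)"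
    and per: "\<And>t. u (t + 2*pi) = u t" "\<And>t. q (t + 2*pi) = q t"
  shows "periodic_solution \<epsilon> (\<lambda>\<tau>. u (omega1 * \<tau>)) (\<lambda>\<tau>. sqrt 2 * u (omega1 * \<tau>) + q (omega1 * \<tau>))"
proof -
  let ?a = omega1
  have ch: "((\<lambda>\<tau>. f (?a * \<tau>)) has_real_derivative ?a * f' (?a * \<tau>)) (at \<tau>)"
    if "\<And>t. (f has_real_derivative f' t) (at t)" for f f' \<tau>
  proof -
    have "((\<lambda>\<tau>. ?a * \<tau>) has_real_derivative ?a) (at \<tau>)" by (auto intro!: derivative_eq_intros)
    from DERIV_chain2[OF that this] show ?thesis by (simp add: mult.commute)
  qed
  have s2: "sqrt 2 * sqrt 2 = 2" by simp
  have a2: "?a * ?a = 2 - sqrt 2" using omega1_squared by (simp add: power2_eq_square)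
  \<comment> \<open>The coupling \<open>(1 + sqrt 2) / sqrt 2\<close> is the reciprocal of
    \<open>omega1\<^sup>2\<close>.\<close>
  have div: "(2 - sqrt 2) * ((1 + sqrt 2) / sqrt 2 * x) = x" for x
    by (simp add: field_simps)
  have e1: "?a * (?a * (- x + (1 + sqrt 2) / sqrt 2 * y)) = - 2 * x + (sqrt 2 * x + y)" for x y
  proof -
    have "?a * (?a * (- x + (1 + sqrt 2) / sqrt 2 * y))
      = (?a * ?a) * (- x) + (?a * ?a) * ((1 + sqrt 2) / sqrt 2 * y)" by algebra
    then show ?thesis unfolding a2 div by algebra
  qed
  have eg: "?a * (?a * (\<epsilon> / ?a\<^sup>2 * z)) = \<epsilon> * z" for z
    using omega1_pos by (simp add: power2_eq_square)
  have e2: "sqrt 2 * (?a * (?a * (- x + (1 + sqrt 2) / sqrt 2 * y)))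
      + ?a * (?a * (\<epsilon> / ?a\<^sup>2 * z - (1 + sqrt 2)\<^sup>2 * y)) = 2 * x - 2 * (sqrt 2 * x + y) + \<epsilon> * z" for x y z
  proof -
    have "?a * (?a * (\<epsilon> / ?a\<^sup>2 * z - (1 + sqrt 2)\<^sup>2 * y))
      = ?a * (?a * (\<epsilon> / ?a\<^sup>2 * z)) - (?a * ?a) * ((1 + sqrt 2)\<^sup>2 * y)" by algebra
    then show ?thesis unfolding e1 eg a2 using s2 by algebra
  qed
  have 1: "((\<lambda>\<tau>. u (?a * \<tau>)) has_real_derivative ?a * v (?a * \<tau>)) (at \<tau>)" for \<tau>
    by (rule ch[OF u])
  have 2: "((\<lambda>\<tau>. sqrt 2 * u (?a * \<tau>) + q (?a * \<tau>)) has_real_derivative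
      sqrt 2 * (?a * v (?a * \<tau>)) + ?a * r (?a * \<tau>)) (at \<tau>)" for \<tau>
    by (intro DERIV_add DERIV_cmult ch u q)
  have 3: "((\<lambda>\<tau>. ?a * v (?a * \<tau>)) has_real_derivative
      - 2 * u (?a * \<tau>) + (sqrt 2 * u (?a * \<tau>) + q (?a * \<tau>))) (at \<tau>)" for \<tau>
    using DERIV_cmult[OF ch[OF v], of ?a] unfolding e1 .
  have 4: "((\<lambda>\<tau>. sqrt 2 * (?a * v (?a * \<tau>)) + ?a * r (?a * \<tau>)) has_real_derivative
      2 * u (?a * \<tau>) - 2 * (sqrt 2 * u (?a * \<tau>) + q (?a * \<tau>))
        + \<epsilon> * ((1 - (u (?a * \<tau>))\<^sup>2) * sin (?a * \<tau>))) (at \<tau>)" for \<tau>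
    using DERIV_add[OF DERIV_cmult[OF DERIV_cmult[OF ch[OF v, of \<tau>]]]
        DERIV_cmult[OF ch[OF r, of \<tau>]], of "sqrt 2" ?a ?a] unfolding e2 .
  have "pendulum_solution \<epsilon> (\<lambda>\<tau>. u (?a * \<tau>)) (\<lambda>\<tau>. sqrt 2 * u (?a * \<tau>) + q (?a * \<tau>))"
    unfolding pendulum_solution_def
    by (intro exI[of _ "\<lambda>\<tau>. ?a * v (?a * \<tau>)"]
        exI[of _ "\<lambda>\<tau>. sqrt 2 * (?a * v (?a * \<tau>)) + ?a * r (?a * \<tau>)"] allI conjI 1 2 3)
      (use 4 in \<open>simp add: mult.assoc\<close>)
  moreover have "?a * (\<tau> + 2*pi / ?a) = ?a * \<tau> + 2*pi" for \<tau>
    using omega1_pos by (simp add: field_simps)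
  ultimately show ?thesis
    unfolding periodic_solution_def using omega1_pos per
    by (intro conjI exI[of _ "2*pi / ?a"]) (auto simp: periodic_fun_simple_def)
qed

text \<open>The hypotheses are the averaged equations, so both amplitudes are covered at once. The
  error bound is uniform in \<tau> and linear in \<epsilon>; it serves both for the limit and for
  telling the two families apart.\<close>

lemma bifurcation:
  fixes A B :: real
  assumes AB: "A * B = 0" "A\<^sup>2 + 3 * B\<^sup>2 = 4"
  defines "us \<equiv> \<lambda>t. A * cos t + B * sin t"
  obtains C \<epsilon>0 \<theta>1 \<theta>2 where "0 \<le> C" "0 < \<epsilon>0"
    "\<And>\<epsilon>. \<bar>\<epsilon>\<bar> < \<epsilon>0 \<Longrightarrow> periodic_solution \<epsilon> (\<theta>1 \<epsilon>) (\<theta>2 \<epsilon>)"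
    "\<And>\<epsilon> \<tau>. \<bar>\<epsilon>\<bar> < \<epsilon>0 \<Longrightarrow> \<bar>\<theta>1 \<epsilon> \<tau> - us (omega1 * \<tau>)\<bar> \<le> C * \<bar>\<epsilon>\<bar>"
    "\<And>\<epsilon> \<tau>. \<bar>\<epsilon>\<bar> < \<epsilon>0 \<Longrightarrow> \<bar>\<theta>2 \<epsilon> \<tau> - sqrt 2 * us (omega1 * \<tau>)\<bar> \<le> C * \<bar>\<epsilon>\<bar>"
proof -
  define c :: real where "c = 1 + sqrt 2"
  have c: "c \<noteq> 0" "sin (c * pi) \<noteq> 0"
    using nonresonance by (auto simp: c_def add_nonneg_eq_0_iff)
  define k1 k1' k2 k2' where "k1 = (\<lambda>s::real. - (s * sin s) / (2*pi))"
    and "k1' = (\<lambda>s::real. - (sin s + s * cos s) / (2*pi))"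
    and "k2 = (\<lambda>s. cos (c * (pi - s)) / (2 * c * sin (c * pi)))"
    and "k2' = (\<lambda>s. sin (c * (pi - s)) / (2 * sin (c * pi)))"
  \<comment> \<open>Since \<theta>1 = (p - q) / (2 sqrt 2), \<open>k\<close> is the kernel through
    which the forcing acts on \<theta>1.\<close>
  define b where "b = 1 / (2 * sqrt 2)"
  define k where "k = (\<lambda>s. b * k1 s + (- b) * k2 s)"
  have contk: "continuous_on UNIV k1" "continuous_on UNIV k2"
    unfolding k1_def k2_def using c by (auto intro!: continuous_intros)
  have dk: "(k has_real_derivative b * k1' s + (- b) * k2' s) (at s)" for s
    unfolding k_def k1_def k2_def k1'_def k2'_def using c
    by (auto intro!: derivative_eq_intros simp: field_simps)
  have contk': "continuous_on UNIV (\<lambda>s. b * k1' s + (- b) * k2' s)"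
    unfolding k1'_def k2'_def using c by (auto intro!: continuous_intros)
  define \<Delta> where "\<Delta> = 3 * B\<^sup>2 - A\<^sup>2"
  \<comment> \<open>One of \<open>A\<close>, \<open>B\<close> vanishes, so \<Delta> is 4 or
    -4.\<close>
  have \<Delta>0: "\<Delta> \<noteq> 0" using AB by (auto simp: \<Delta>_def)
  \<comment> \<open>Inverse of the Jacobian of the averaged equations, whose determinant is a multiple of \<open>\<Delta>\<close>\<close>
  define m1 m2 where "m1 = (\<lambda>s::real. 6 * B / (pi * \<Delta>) * (sin s * cos s) + 2 * A / (pi * \<Delta>) * (sin s)\<^sup>2)"
    and "m2 = (\<lambda>s::real. - 2 * A / (pi * \<Delta>) * (sin s * cos s) + - 2 * B / (pi * \<Delta>) * (sin s)\<^sup>2)"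
  have contm: "continuous_on UNIV m1" "continuous_on UNIV m2"
    unfolding m1_def m2_def by (intro continuous_intros)+
  have contus: "continuous_on UNIV us" unfolding us_def by (intro continuous_intros)
  have usper: "us (t + 2*pi) = us t" for t by (simp add: us_def)
  define U where "U = \<bar>A\<bar> + \<bar>B\<bar>"
  have U: "\<bar>us t\<bar> \<le> U" for t
  proof -
    have "\<bar>A * cos t\<bar> \<le> \<bar>A\<bar> * 1" "\<bar>B * sin t\<bar> \<le> \<bar>B\<bar> * 1"
      unfolding abs_mult by (intro mult_left_mono; simp)+
    then show ?thesis unfolding us_def U_def by linarith
  qed
  obtain C e0 where C: "0 \<le> C" and e0: "0 < e0" and fp: "\<And>e. \<bar>e\<bar> < e0 \<Longrightarrow>
    \<exists>\<eta> w. continuous_on UNIV \<eta> \<and> (\<forall>t. \<eta> (t + 2*pi) = \<eta> t) \<and> (\<forall>t. \<bar>\<eta> t\<bar> \<le> C * \<bar>e\<bar>)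
       \<and> w = (\<lambda>t. e * conv k (\<lambda>s. (1 - (us s + \<eta> s)\<^sup>2) * sin s) t)
       \<and> (\<forall>t. \<eta> t = cos t * conv m1 (\<lambda>s. 2 * us s * w s + (\<eta> s)\<^sup>2) 0
                   + sin t * conv m2 (\<lambda>s. 2 * us s * w s + (\<eta> s)\<^sup>2) 0 + w t)"
    by (rule reduced_fixed_point[OF dk contk' contm contus usper U]) (rule that)
  define M where "M = 1 / \<bar>2 * c * sin (c * pi)\<bar>"
  have M: "\<bar>k2 s\<bar> \<le> M" for s
    unfolding k2_def M_def abs_divide by (intro divide_right_mono) auto
  \<comment> \<open>\<open>G\<close> bounds the forcing. \<open>K\<close> collects the error of
    \<theta>2, namely sqrt 2 times that of \<theta>1 plus the size of \<open>q\<close>, and also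
    dominates \<open>C\<close>.\<close>
  define G where "G = 1 + (U + C * e0)\<^sup>2"
  define K where "K = sqrt 2 * C + 2 * pi * M * G"
  have K: "C \<le> K" "0 \<le> K"
  proof -
    have "1 * C \<le> sqrt 2 * C" using C by (intro mult_right_mono) auto
    moreover have "0 \<le> 2 * pi * M * G" by (simp add: M_def G_def)
    ultimately show "C \<le> K" "0 \<le> K" using C unfolding K_def by linarith+
  qed
  have ex: "\<exists>\<theta>1 \<theta>2. periodic_solution \<epsilon> \<theta>1 \<theta>2
      \<and> (\<forall>\<tau>. \<bar>\<theta>1 \<tau> - us (omega1 * \<tau>)\<bar> \<le> K / omega1\<^sup>2 * \<bar>\<epsilon>\<bar>)
      \<and> (\<forall>\<tau>. \<bar>\<theta>2 \<tau> - sqrt 2 * us (omega1 * \<tau>)\<bar> \<le> K / omega1\<^sup>2 * \<bar>\<epsilon>\<bar>)"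
    if \<epsilon>: "\<bar>\<epsilon>\<bar> < omega1\<^sup>2 * e0" for \<epsilon>
  proof -
    define e where "e = \<epsilon> / omega1\<^sup>2"
    have abs_e: "\<bar>e\<bar> = \<bar>\<epsilon>\<bar> / omega1\<^sup>2" by (simp add: e_def abs_divide)
    have e: "\<bar>e\<bar> < e0"
      using \<epsilon> omega1_pos by (simp add: abs_e field_simps)
    obtain \<eta> w where cont\<eta>: "continuous_on UNIV \<eta>" and \<eta>per: "\<And>t. \<eta> (t + 2*pi) = \<eta> t"
      and \<eta>C: "\<And>t. \<bar>\<eta> t\<bar> \<le> C * \<bar>e\<bar>"
      and w: "w = (\<lambda>t. e * conv k (\<lambda>s. (1 - (us s + \<eta> s)\<^sup>2) * sin s) t)"
      and \<eta>: "\<And>t. \<eta> t = cos t * conv m1 (\<lambda>s. 2 * us s * w s + (\<eta> s)\<^sup>2) 0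
                   + sin t * conv m2 (\<lambda>s. 2 * us s * w s + (\<eta> s)\<^sup>2) 0 + w t"
      using fp[OF e] by blast
    define N \<alpha> \<beta> where "N = (\<lambda>s. 2 * us s * w s + (\<eta> s)\<^sup>2)"
      and "\<alpha> = conv m1 N 0" and "\<beta> = conv m2 N 0"
    have \<eta>': "\<eta> t = cos t * \<alpha> + sin t * \<beta> + w t" for t
      unfolding \<alpha>_def \<beta>_def N_def by (rule \<eta>)
    define g where "g = (\<lambda>s. (1 - (us s + \<eta> s)\<^sup>2) * sin s)"
    have contg: "continuous_on UNIV g" unfolding g_def by (intro continuous_intros contus cont\<eta>)
    have gper: "g (t + 2*pi) = g t" for t by (simp add: g_def usper \<eta>per)
    \<comment> \<open>The fixed point equation is solved for \<open>w\<close>.\<close>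
    have "continuous_on UNIV (\<lambda>t. \<eta> t - cos t * \<alpha> - sin t * \<beta>)"
      by (intro continuous_intros cont\<eta>)
    then have contw: "continuous_on UNIV w" unfolding \<eta>' by simp
    have contN: "continuous_on UNIV N"
      unfolding N_def by (intro continuous_intros contus contw cont\<eta>)
    define I J where "I = conv (\<lambda>s. sin s * cos s) N 0" and "J = conv (\<lambda>s. (sin s)\<^sup>2) N 0"
    have conttrig: "continuous_on UNIV (\<lambda>s::real. sin s * cos s)" "continuous_on UNIV (\<lambda>s::real. (sin s)\<^sup>2)"
      by (intro continuous_intros)+
    have \<alpha>: "\<alpha> * (pi * \<Delta>) = 6 * B * I + 2 * A * J" and \<beta>: "\<beta> * (pi * \<Delta>) = - 2 * A * I - 2 * B * J"
      using \<Delta>0 unfolding \<alpha>_def \<beta>_def m1_def m2_def conv_lincomb[OF conttrig contN] I_def J_def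
      by (simp_all add: field_simps)
    have H: "conv cos g 0 = - pi / 2 * (A * B + A * \<beta> + B * \<alpha>) + I"
      "conv sin g 0 = - pi + pi / 4 * (A\<^sup>2 + 2 * A * \<alpha>) + 3 * pi / 4 * (B\<^sup>2 + 2 * B * \<beta>) + J"
      using forcing_harmonics[OF \<eta>' contw, of A B] unfolding I_def J_def N_def g_def us_def by auto
    \<comment> \<open>Multiplying by \<Delta> allows the formulas for \<alpha> and \<beta> to be
      inserted; the averaged equations remove the constant terms, and what remains cancels by the
      choice of \<open>m1\<close> and \<open>m2\<close>.\<close>
    have "\<Delta> * conv cos g 0 = \<Delta> * I - (A * (\<beta> * (pi * \<Delta>)) + B * (\<alpha> * (pi * \<Delta>))) / 2"
      unfolding H AB by (simp add: algebra_simps)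
    also have "\<dots> = 0" unfolding \<alpha> \<beta> unfolding \<Delta>_def by (simp add: field_simps power2_eq_square)
    finally have h1: "conv cos g 0 = 0" using \<Delta>0 by simp
    have "conv sin g 0 = pi / 4 * (A\<^sup>2 + 3 * B\<^sup>2 - 4) + pi / 2 * (A * \<alpha> + 3 * B * \<beta>) + J"
      unfolding H by (simp add: field_simps)
    then have "\<Delta> * conv sin g 0 = \<Delta> * J + (A * (\<alpha> * (pi * \<Delta>)) + 3 * B * (\<beta> * (pi * \<Delta>))) / 2"
      unfolding AB by (simp add: field_simps)
    also have "\<dots> = 0" unfolding \<alpha> \<beta> unfolding \<Delta>_def by (simp add: field_simps power2_eq_square)
    finally have h2: "conv sin g 0 = 0" using \<Delta>0 by simp
    note orth = conv_cos_vanishes[OF contg gper h1 h2]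
    note D1 = resonant_kernel[OF contg gper orth, folded k1_def k1'_def]
    note D2 = nonresonant_kernel[OF c contg gper, folded k2_def k2'_def]
    \<comment> \<open>\<open>u\<close> is the candidate for \<theta>1 and \<open>q\<close> for
      \<theta>2 - sqrt 2 \<theta>1, with derivatives \<open>v\<close> and \<open>r\<close>.\<close>
    define u where "u = (\<lambda>t. us t + \<eta> t)"
    define q r where "q = (\<lambda>t. e * conv k2 g t)" and "r = (\<lambda>t. e * conv k2' g t)"
    define v where "v = (\<lambda>t. - (A + \<alpha>) * sin t + (B + \<beta>) * cos t
      + e * b * (conv k1' g t - conv k2' g t))"
    have w': "w t = e * b * (conv k1 g t - conv k2 g t)" for t
    proof -
      have "w t = e * conv k g t" unfolding w g_def ..
      then show ?thesis unfolding k_def conv_lincomb[OF contk contg] by (simp add: algebra_simps)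
    qed
    have u: "u = (\<lambda>t. (A + \<alpha>) * cos t + (B + \<beta>) * sin t + e * b * (conv k1 g t - conv k2 g t))"
      unfolding u_def us_def \<eta>' w' by (simp add: algebra_simps)
    \<comment> \<open>In \<open>v'\<close> the two copies of \<open>g\<close> cancel, because
      \<theta>1 is not forced directly; the remaining coefficient of \<open>q\<close> is this
      one.\<close>
    have b: "b * (c\<^sup>2 - 1) = c / sqrt 2"
      unfolding b_def c_def by (simp add: field_simps power2_eq_square)
    have C_le: "C * \<bar>e\<bar> \<le> K / omega1\<^sup>2 * \<bar>\<epsilon>\<bar>"
      using mult_right_mono[OF K(1), of "\<bar>e\<bar>"] by (simp add: abs_e)
    have "periodic_solution \<epsilon> (\<lambda>\<tau>. u (omega1 * \<tau>)) (\<lambda>\<tau>. sqrt 2 * u (omega1 * \<tau>) + q (omega1 * \<tau>))"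
    proof (rule periodic_solution_rescale)
      fix t
      show "(u has_real_derivative v t) (at t)"
        unfolding u v_def by (auto intro!: derivative_eq_intros D1 D2 simp: algebra_simps)
      have "(v has_real_derivative - (A + \<alpha>) * cos t - (B + \<beta>) * sin t
        + e * b * ((g t - conv k1 g t) - (g t - c\<^sup>2 * conv k2 g t))) (at t)"
        unfolding v_def by (auto intro!: derivative_eq_intros D1 D2 simp: algebra_simps)
      also have "- (A + \<alpha>) * cos t - (B + \<beta>) * sin t
        + e * b * ((g t - conv k1 g t) - (g t - c\<^sup>2 * conv k2 g t)) = - u t + (b * (c\<^sup>2 - 1)) * q t"
        unfolding u q_def by algebra
      finally show "(v has_real_derivative - u t + (1 + sqrt 2) / sqrt 2 * q t) (at t)"
        unfolding b unfolding c_def .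
      show "(q has_real_derivative r t) (at t)"
        unfolding q_def r_def by (intro DERIV_cmult D2)
      have "(r has_real_derivative e * (g t - c\<^sup>2 * conv k2 g t)) (at t)"
        unfolding r_def by (intro DERIV_cmult D2)
      then show "(r has_real_derivative
          \<epsilon> / omega1\<^sup>2 * ((1 - (u t)\<^sup>2) * sin t) - (1 + sqrt 2)\<^sup>2 * q t) (at t)"
        unfolding q_def e_def[symmetric] c_def[symmetric] u_def g_def by (simp add: algebra_simps)
      show "u (t + 2*pi) = u t" by (simp add: u_def usper \<eta>per)
      show "q (t + 2*pi) = q t" unfolding q_def by (simp add: conv_periodic[of g, OF gper])
    qed
    moreover have "\<bar>u (omega1 * \<tau>) - us (omega1 * \<tau>)\<bar> \<le> K / omega1\<^sup>2 * \<bar>\<epsilon>\<bar>" for \<tau>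
      using \<eta>C[of "omega1 * \<tau>"] C_le by (simp add: u_def)
    moreover have "\<bar>sqrt 2 * u t + q t - sqrt 2 * us t\<bar> \<le> K / omega1\<^sup>2 * \<bar>\<epsilon>\<bar>" for t
    proof -
      have "\<bar>g s\<bar> \<le> G" for s
      proof -
        have "C * \<bar>e\<bar> \<le> C * e0" using C e by (intro mult_left_mono) auto
        then have "\<bar>us s + \<eta> s\<bar> \<le> \<bar>U + C * e0\<bar>" using U[of s] \<eta>C[of s] by linarith
        then have "(us s + \<eta> s)\<^sup>2 \<le> (U + C * e0)\<^sup>2" by (simp only: abs_le_square_iff)
        then have "\<bar>1 - (us s + \<eta> s)\<^sup>2\<bar> \<le> G"
          using zero_le_power2[of "us s + \<eta> s"] zero_le_power2[of "U + C * e0"] unfolding G_def by linarith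
        then have "\<bar>1 - (us s + \<eta> s)\<^sup>2\<bar> * \<bar>sin s\<bar> \<le> G * 1" by (intro mult_mono) (auto simp: G_def)
        then show ?thesis by (simp add: g_def abs_mult)
      qed
      then have "\<bar>conv k2 g t\<bar> \<le> 2 * pi * M * G"
        by (intro conv_bound contk contg M)
      then have "\<bar>q t\<bar> \<le> 2 * pi * M * G * \<bar>e\<bar>"
        unfolding q_def abs_mult by (simp add: mult.commute[of "\<bar>e\<bar>"] mult_right_mono)
      moreover have "\<bar>sqrt 2 * \<eta> t\<bar> \<le> sqrt 2 * (C * \<bar>e\<bar>)"
        unfolding abs_mult using \<eta>C[of t] by (intro mult_mono) auto
      moreover have "K / omega1\<^sup>2 * \<bar>\<epsilon>\<bar> = sqrt 2 * (C * \<bar>e\<bar>) + 2 * pi * M * G * \<bar>e\<bar>"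
        unfolding K_def abs_e by (simp add: algebra_simps add_divide_distrib)
      moreover have "sqrt 2 * u t + q t - sqrt 2 * us t = sqrt 2 * \<eta> t + q t"
        unfolding u_def by algebra
      ultimately show ?thesis by linarith
    qed
    ultimately show ?thesis
      by (intro exI[of _ "\<lambda>\<tau>. u (omega1 * \<tau>)"]
          exI[of _ "\<lambda>\<tau>. sqrt 2 * u (omega1 * \<tau>) + q (omega1 * \<tau>)"]) blast
  qed
  then obtain \<theta>1 \<theta>2 where \<theta>: "\<And>\<epsilon>. \<bar>\<epsilon>\<bar> < omega1\<^sup>2 * e0 \<Longrightarrow> periodic_solution \<epsilon> (\<theta>1 \<epsilon>) (\<theta>2 \<epsilon>)
      \<and> (\<forall>\<tau>. \<bar>\<theta>1 \<epsilon> \<tau> - us (omega1 * \<tau>)\<bar> \<le> K / omega1\<^sup>2 * \<bar>\<epsilon>\<bar>)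
      \<and> (\<forall>\<tau>. \<bar>\<theta>2 \<epsilon> \<tau> - sqrt 2 * us (omega1 * \<tau>)\<bar> \<le> K / omega1\<^sup>2 * \<bar>\<epsilon>\<bar>)"
    by metis
  show thesis
    using that[of "K / omega1\<^sup>2" "omega1\<^sup>2 * e0" \<theta>1 \<theta>2] K e0 omega1_pos \<theta> by auto
qed

section \<open>The two given amplitudes and the limit of vanishing \<epsilon>\<close>

lemma unperturbed_eq:
  "unperturbed1 X Y \<tau> = X / sqrt (4 - 2 * sqrt 2) * cos (omega1 * \<tau>) + Y / sqrt (4 - 2 * sqrt 2) * sin (omega1 * \<tau>)"
  "unperturbed2 X Y \<tau> = sqrt 2 * unperturbed1 X Y \<tau>"
proof -
  show "unperturbed1 X Y \<tau> = X / sqrt (4 - 2 * sqrt 2) * cos (omega1 * \<tau>) + Y / sqrt (4 - 2 * sqrt 2) * sin (omega1 * \<tau>)"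
    by (simp add: unperturbed1_def distrib_left)
  have "4 - 2 * sqrt 2 = 2 * (2 - sqrt 2)" by simp
  then have "sqrt (4 - 2 * sqrt 2) = sqrt 2 * sqrt (2 - sqrt 2)" by (metis real_sqrt_mult)
  then show "unperturbed2 X Y \<tau> = sqrt 2 * unperturbed1 X Y \<tau>"
    by (simp add: unperturbed1_def unperturbed2_def)
qed

lemma unperturbed_periodic_solution: "periodic_solution 0 (unperturbed1 X Y) (unperturbed2 X Y)"
proof -
  define A B where "A = X / sqrt (4 - 2 * sqrt 2)" and "B = Y / sqrt (4 - 2 * sqrt 2)"
  have "periodic_solution 0 (\<lambda>\<tau>. A * cos (omega1 * \<tau>) + B * sin (omega1 * \<tau>))
     (\<lambda>\<tau>. sqrt 2 * (A * cos (omega1 * \<tau>) + B * sin (omega1 * \<tau>)) + 0)"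
    \<comment> \<open>The unperturbed solutions lie in the first normal mode, hence \<open>q\<close>
      and its derivative are 0.\<close>
    by (rule periodic_solution_rescale[of "\<lambda>t. A * cos t + B * sin t" "\<lambda>t. - A * sin t + B * cos t"
          "\<lambda>_. 0" "\<lambda>_. 0"]) (auto intro!: derivative_eq_intros)
  moreover have "unperturbed1 X Y = (\<lambda>\<tau>. A * cos (omega1 * \<tau>) + B * sin (omega1 * \<tau>))"
    "unperturbed2 X Y = (\<lambda>\<tau>. sqrt 2 * (A * cos (omega1 * \<tau>) + B * sin (omega1 * \<tau>)) + 0)"
    unfolding A_def B_def unperturbed_eq(1)[symmetric] by (auto simp: unperturbed_eq(2))
  ultimately show ?thesis by simp
qed

lemma tendsto_of_linear_bound:
  fixes f :: "real \<Rightarrow> real"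
  assumes "0 < \<epsilon>0" and "\<And>\<epsilon>. \<bar>\<epsilon>\<bar> < \<epsilon>0 \<Longrightarrow> \<bar>f \<epsilon> - l\<bar> \<le> C * \<bar>\<epsilon>\<bar>"
  shows "(f \<longlongrightarrow> l) (at 0)"
proof -
  have "\<forall>\<^sub>F \<epsilon> in at 0. norm (f \<epsilon> - l) \<le> C * \<bar>\<epsilon>\<bar>"
    using assms unfolding eventually_at by (auto simp: dist_real_def)
  moreover have "((\<lambda>\<epsilon>. C * \<bar>\<epsilon>\<bar>) \<longlongrightarrow> 0) (at (0::real))"
    by (auto intro!: tendsto_eq_intros)
  ultimately have "((\<lambda>\<epsilon>. f \<epsilon> - l) \<longlongrightarrow> 0) (at 0)" by (rule Lim_null_comparison)
  then show ?thesis by (simp add: LIM_zero_iff)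
qed

text \<open>The clause that the families differ at some \<tau> ensures that there are two solutions
  rather than one counted twice.\<close>

theorem corollary2:
  fixes Xa Ya Xb Yb :: real
  defines "Xa \<equiv> 2 * sqrt (2 * (2 - sqrt 2))" and "Ya \<equiv> 0"
    and "Xb \<equiv> 0" and "Yb \<equiv> 2 * sqrt (2 / 3 * (2 - sqrt 2))"
  shows "periodic_solution 0 (unperturbed1 Xa Ya) (unperturbed2 Xa Ya) \<and>
         periodic_solution 0 (unperturbed1 Xb Yb) (unperturbed2 Xb Yb) \<and>
         (\<exists>\<epsilon>0>0. \<exists>\<phi>1 \<phi>2 \<psi>1 \<psi>2 :: real \<Rightarrow> real \<Rightarrow> real.
            (\<forall>\<epsilon>. \<epsilon> \<noteq> 0 \<and> \<bar>\<epsilon>\<bar> < \<epsilon>0 \<longrightarrow>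
               periodic_solution \<epsilon> (\<lambda>\<tau>. \<phi>1 \<tau> \<epsilon>) (\<lambda>\<tau>. \<phi>2 \<tau> \<epsilon>) \<and>
               periodic_solution \<epsilon> (\<lambda>\<tau>. \<psi>1 \<tau> \<epsilon>) (\<lambda>\<tau>. \<psi>2 \<tau> \<epsilon>) \<and>
               (\<exists>\<tau>. (\<phi>1 \<tau> \<epsilon>, \<phi>2 \<tau> \<epsilon>) \<noteq> (\<psi>1 \<tau> \<epsilon>, \<psi>2 \<tau> \<epsilon>))) \<and>
            (\<forall>\<tau>. ((\<lambda>\<epsilon>. \<phi>1 \<tau> \<epsilon>) \<longlongrightarrow> unperturbed1 Xa Ya \<tau>) (at 0) \<and>
                  ((\<lambda>\<epsilon>. \<phi>2 \<tau> \<epsilon>) \<longlongrightarrow> unperturbed2 Xa Ya \<tau>) (at 0) \<and>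
                  ((\<lambda>\<epsilon>. \<psi>1 \<tau> \<epsilon>) \<longlongrightarrow> unperturbed1 Xb Yb \<tau>) (at 0) \<and>
                  ((\<lambda>\<epsilon>. \<psi>2 \<tau> \<epsilon>) \<longlongrightarrow> unperturbed2 Xb Yb \<tau>) (at 0)))"
proof -
  have pos: "0 < 2 - sqrt (2::real)" using sqrt2_less_2 by simp
  have four: "4 - 2 * sqrt 2 = 2 * (2 - sqrt (2::real))" by simp
  \<comment> \<open>Normalising turns the two initial data into the amplitudes \<open>(A, B)\<close>
    equal to (2, 0) and (0, 2 / sqrt 3), which solve the averaged equations.\<close>
  have Xa: "Xa / sqrt (4 - 2 * sqrt 2) = 2"
    unfolding Xa_def four using pos by simp
  have Yb: "Yb / sqrt (4 - 2 * sqrt 2) = 2 / sqrt 3"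
    unfolding Yb_def four using pos by (simp add: real_sqrt_mult real_sqrt_divide)
  have A: "unperturbed1 Xa Ya \<tau> = 2 * cos (omega1 * \<tau>) + 0 * sin (omega1 * \<tau>)" for \<tau>
    unfolding unperturbed_eq Xa by (simp add: Ya_def)
  have B: "unperturbed1 Xb Yb \<tau> = 0 * cos (omega1 * \<tau>) + 2 / sqrt 3 * sin (omega1 * \<tau>)" for \<tau>
    unfolding unperturbed_eq Yb by (simp add: Xb_def)
  have cond: "(2::real) * 0 = 0" "(2::real)\<^sup>2 + 3 * 0\<^sup>2 = 4"
    "0 * (2 / sqrt 3) = (0::real)" "0\<^sup>2 + 3 * (2 / sqrt 3)\<^sup>2 = (4::real)"
    by (simp_all add: power_divide)
  obtain C1 \<delta>1 \<phi>1 \<phi>2 where 1: "0 \<le> C1" "0 < \<delta>1"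
    and \<phi>: "\<And>\<epsilon>. \<bar>\<epsilon>\<bar> < \<delta>1 \<Longrightarrow> periodic_solution \<epsilon> (\<phi>1 \<epsilon>) (\<phi>2 \<epsilon>)"
    and \<phi>1: "\<And>\<epsilon> \<tau>. \<bar>\<epsilon>\<bar> < \<delta>1 \<Longrightarrow> \<bar>\<phi>1 \<epsilon> \<tau> - unperturbed1 Xa Ya \<tau>\<bar> \<le> C1 * \<bar>\<epsilon>\<bar>"
    and \<phi>2: "\<And>\<epsilon> \<tau>. \<bar>\<epsilon>\<bar> < \<delta>1 \<Longrightarrow> \<bar>\<phi>2 \<epsilon> \<tau> - unperturbed2 Xa Ya \<tau>\<bar> \<le> C1 * \<bar>\<epsilon>\<bar>"
    using bifurcation[OF cond(1,2)] unfolding A[symmetric] unperturbed_eq(2)[symmetric] by blast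
  obtain C2 \<delta>2 \<psi>1 \<psi>2 where 2: "0 \<le> C2" "0 < \<delta>2"
    and \<psi>: "\<And>\<epsilon>. \<bar>\<epsilon>\<bar> < \<delta>2 \<Longrightarrow> periodic_solution \<epsilon> (\<psi>1 \<epsilon>) (\<psi>2 \<epsilon>)"
    and \<psi>1: "\<And>\<epsilon> \<tau>. \<bar>\<epsilon>\<bar> < \<delta>2 \<Longrightarrow> \<bar>\<psi>1 \<epsilon> \<tau> - unperturbed1 Xb Yb \<tau>\<bar> \<le> C2 * \<bar>\<epsilon>\<bar>"
    and \<psi>2: "\<And>\<epsilon> \<tau>. \<bar>\<epsilon>\<bar> < \<delta>2 \<Longrightarrow> \<bar>\<psi>2 \<epsilon> \<tau> - unperturbed2 Xb Yb \<tau>\<bar> \<le> C2 * \<bar>\<epsilon>\<bar>"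
    using bifurcation[OF cond(3,4)] unfolding B[symmetric] unperturbed_eq(2)[symmetric] by blast
  \<comment> \<open>At \<tau> = 0 the unperturbed \<theta>1 are 2 and 0. The last bound keeps the
    sum of both errors below 1, so the families stay apart; the summand 1 keeps the denominator
    positive.\<close>
  define \<epsilon>0 where "\<epsilon>0 = min (min \<delta>1 \<delta>2) (1 / (C1 + C2 + 1))"
  have \<epsilon>0: "0 < \<epsilon>0" using 1 2 by (simp add: \<epsilon>0_def)
  have distinct: "\<phi>1 \<epsilon> 0 \<noteq> \<psi>1 \<epsilon> 0" if "\<bar>\<epsilon>\<bar> < \<epsilon>0" for \<epsilon>
  proof
    assume eq: "\<phi>1 \<epsilon> 0 = \<psi>1 \<epsilon> 0"
    have "\<bar>\<epsilon>\<bar> * (C1 + C2 + 1) < 1" using that 1 2 by (simp add: \<epsilon>0_def field_simps)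
    then have "C1 * \<bar>\<epsilon>\<bar> + C2 * \<bar>\<epsilon>\<bar> < 1" by (simp add: algebra_simps)
    moreover have "\<bar>\<phi>1 \<epsilon> 0 - 2\<bar> \<le> C1 * \<bar>\<epsilon>\<bar>" "\<bar>\<psi>1 \<epsilon> 0\<bar> \<le> C2 * \<bar>\<epsilon>\<bar>"
      using that \<phi>1[of \<epsilon> 0] \<psi>1[of \<epsilon> 0] unfolding A B by (auto simp: \<epsilon>0_def)
    ultimately show False using eq by linarith
  qed
  show ?thesis
  proof (rule conjI[OF unperturbed_periodic_solution conjI[OF unperturbed_periodic_solution]],
      rule exI[of _ \<epsilon>0], rule conjI[OF \<epsilon>0],
      rule exI[of _ "\<lambda>\<tau> \<epsilon>. \<phi>1 \<epsilon> \<tau>"], rule exI[of _ "\<lambda>\<tau> \<epsilon>. \<phi>2 \<epsilon> \<tau>"],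
      rule exI[of _ "\<lambda>\<tau> \<epsilon>. \<psi>1 \<epsilon> \<tau>"], rule exI[of _ "\<lambda>\<tau> \<epsilon>. \<psi>2 \<epsilon> \<tau>"],
      intro conjI allI impI)
    fix \<epsilon> :: real assume \<epsilon>: "\<epsilon> \<noteq> 0 \<and> \<bar>\<epsilon>\<bar> < \<epsilon>0"
    show "periodic_solution \<epsilon> (\<phi>1 \<epsilon>) (\<phi>2 \<epsilon>)" "periodic_solution \<epsilon> (\<psi>1 \<epsilon>) (\<psi>2 \<epsilon>)"
      using \<phi> \<psi> \<epsilon> by (simp_all add: \<epsilon>0_def)
    show "\<exists>\<tau>. (\<phi>1 \<epsilon> \<tau>, \<phi>2 \<epsilon> \<tau>) \<noteq> (\<psi>1 \<epsilon> \<tau>, \<psi>2 \<epsilon> \<tau>)"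
      using distinct \<epsilon> by blast
  next
    fix \<tau>
    show "((\<lambda>\<epsilon>. \<phi>1 \<epsilon> \<tau>) \<longlongrightarrow> unperturbed1 Xa Ya \<tau>) (at 0)"
      by (rule tendsto_of_linear_bound[OF 1(2)]) (rule \<phi>1)
    show "((\<lambda>\<epsilon>. \<phi>2 \<epsilon> \<tau>) \<longlongrightarrow> unperturbed2 Xa Ya \<tau>) (at 0)"
      by (rule tendsto_of_linear_bound[OF 1(2)]) (rule \<phi>2)
    show "((\<lambda>\<epsilon>. \<psi>1 \<epsilon> \<tau>) \<longlongrightarrow> unperturbed1 Xb Yb \<tau>) (at 0)"
      by (rule tendsto_of_linear_bound[OF 2(2)]) (rule \<psi>1)
    show "((\<lambda>\<epsilon>. \<psi>2 \<epsilon> \<tau>) \<longlongrightarrow> unperturbed2 Xb Yb \<tau>) (at 0)"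
      by (rule tendsto_of_linear_bound[OF 2(2)]) (rule \<psi>2)
  qed
qed

end
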